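(* Let $n,k,s$ be positive integers with $n \geq \max\{2^{8}s^{3/2} \log_2^{3/2}(sk),\ 8 s^2\}$. Then the sequence $(f_1,\ldots,f_s)$ with $f_i = i\cdot n^{k-1}$ for $i\in[s]$ is satisfying; that is, whenever $\mathcal F_1,\ldots,\mathcal F_s\subset [n]^k$ satisfy $|\mathcal F_i|> i\, n^{k-1}$ for every $i\in[s]$, there exist pairwise disjoint $F_1\in\mathcal F_1,\ldots,F_s\in\mathcal F_s$.
   Context: $[n]=\{1,\ldots,n\}$ and $[n]^k$ is the set of all $k$-tuples $(x_1,\ldots,x_k)$ with $x_j\in[n]$. A tuple $(x_1,\ldots,x_k)$ is identified with the $k$-element set $\{(1,x_1),\ldots,(k,x_k)\}\subset[k]\times[n]$; thus two tuples $x,y$ are disjoint iff $x_j\neq y_j$ for all $j\in[k]$. For families $\mathcal F_1,\ldots,\mathcal F_s\subset[n]^k$, a rainbow matching (cross-matching) is a choice of pairwise disjoint $F_1\in\mathcal F_1,\ldots,F_s\in\mathcal F_s$. A sequence of reals $(f_1,\ldots,f_s)$ is called satisfying (for the given $n,k$) if for all families $\mathcal F_1,\ldots,\mathcal F_s\subset[n]^k$ with $|\mathcal F_i|>f_i$ for each $i\in[s]$, the families contain a rainbow matching. *)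

theory Defs
  imports Complex_Main "HOL-Library.FuncSet" "HOL-Library.Disjoint_Sets"
begin

definition tuples :: "nat \<Rightarrow> nat \<Rightarrow> (nat \<Rightarrow> nat) set" where
  "tuples n k = ({1..k} \<rightarrow>\<^sub>E {1..n})"

text \<open>A \<open>k\<close>-tuple is identified with a \<open>k\<close>-element subset of \<open>[k] \<times> [n]\<close>; two tuples
  are disjoint when these sets are.\<close>

definition tuple_set :: "nat \<Rightarrow> (nat \<Rightarrow> nat) \<Rightarrow> (nat \<times> nat) set" where
  "tuple_set k x = {(j, x j) | j. j \<in> {1..k}}"

definition rainbow_matching ::
  "nat \<Rightarrow> nat \<Rightarrow> (nat \<Rightarrow> (nat \<Rightarrow> nat) set) \<Rightarrow> (nat \<Rightarrow> nat \<Rightarrow> nat) \<Rightarrow> bool" where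
  "rainbow_matching k s \<F> F \<longleftrightarrow>
     (\<forall>i\<in>{1..s}. F i \<in> \<F> i) \<and> disjoint_family_on (\<lambda>i. tuple_set k (F i)) {1..s}"

text \<open>The sequences \<open>f\<close> and \<open>\<F>\<close> are indexed from 1; only their values on \<open>{1..s}\<close> matter.\<close>

definition satisfying :: "nat \<Rightarrow> nat \<Rightarrow> nat \<Rightarrow> (nat \<Rightarrow> real) \<Rightarrow> bool" where
  "satisfying n k s f \<longleftrightarrow>
     (\<forall>\<F>. (\<forall>i\<in>{1..s}. \<F> i \<subseteq> tuples n k \<and> real (card (\<F> i)) > f i)
        \<longrightarrow> (\<exists>F. rainbow_matching k s \<F> F))"

lemma disjnt_tuple_set_iff:
  "disjnt (tuple_set k x) (tuple_set k y) \<longleftrightarrow> (\<forall>j\<in>{1..k}. x j \<noteq> y j)"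
  by (fastforce simp: disjnt_def tuple_set_def)

end

theory Submission
  imports Defs
begin

text \<open>
  Call a family \<open>R\<close>-spread if at most a fraction \<open>R\<^sup>-\<^sup>t\<close> of its members contain any given \<open>t\<close>-set.
  Among all sets \<open>Q\<close> choose one maximising \<open>R\<close> to the power \<open>card Q\<close> times the number of tuples of
  \<open>\<F>\<close> through \<open>Q\<close>; then the link of \<open>Q\<close> is \<open>R\<close>-spread.  For \<open>R = 32 s log\<^sub>2 (s k)\<close> the bound on
  \<open>n\<close> gives \<open>2 R\<^sup>3 \<le> n\<^sup>2\<close>, so that such kernels \<open>Q\<close> have at most two elements as long as more than
  \<open>n\<^sup>k\<^sup>-\<^sup>1 / 2\<close> tuples remain.  The hypothesis \<open>card (\<F> i) > i n\<^sup>k\<^sup>-\<^sup>1\<close> together with \<open>n \<ge> 8 s\<^sup>2\<close>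
  then provides pairwise disjoint kernels, one for each \<open>i\<close>.

  The spread links are made disjoint by a uniformly random colouring of the points with \<open>s m\<close>
  colours, \<open>m\<close> of them reserved for each family.  Exposing one colour class \<open>W\<close> at a time, every
  member \<open>S a\<close> is replaced by \<open>S b - W\<close>, where \<open>S b\<close> is a smallest member inside \<open>W \<union> S a\<close>; this at
  least halves the expected size.  Since \<open>2\<^sup>m > s k\<close>, after \<open>m\<close> rounds each family fails with
  probability below \<open>1 / s\<close>.
\<close>

section \<open>Spread families and the exposure of a single colour class\<close>

lemma sum_Pow_power_card_diff:
  fixes q :: real
  assumes "finite X"
  shows "(\<Sum>W\<in>Pow X. q ^ card (X - W)) = (q + 1) ^ card X"
  using prod_add[OF assms, of "\<lambda>_. 1" "\<lambda>_. q"] by (simp add: add.commute)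

definition spread :: "real \<Rightarrow> 'i set \<Rightarrow> ('i \<Rightarrow> 'a set) \<Rightarrow> bool" where
  "spread R A S \<longleftrightarrow>
     (\<forall>T. finite T \<longrightarrow> real (card {a \<in> A. T \<subseteq> S a}) * R ^ card T \<le> real (card A))"

lemma spread_subset:
  fixes S T :: "'i \<Rightarrow> 'a set"
  assumes "spread R A S" "finite A" "R \<ge> 0" "\<And>a. a \<in> A \<Longrightarrow> T a \<subseteq> S a"
  shows "spread R A T"
  unfolding spread_def
proof (intro allI impI)
  fix Y :: "'a set" assume Y: "finite Y"
  have "card {a \<in> A. Y \<subseteq> T a} \<le> card {a \<in> A. Y \<subseteq> S a}"
    using assms by (intro card_mono) auto
  hence "real (card {a \<in> A. Y \<subseteq> T a}) * R ^ card Y \<le> real (card {a \<in> A. Y \<subseteq> S a}) * R ^ card Y"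
    using assms(3) by (intro mult_right_mono) auto
  also have "\<dots> \<le> card A" using assms(1) Y by (auto simp: spread_def)
  finally show "real (card {a \<in> A. Y \<subseteq> T a}) * R ^ card Y \<le> real (card A)" .
qed

text \<open>Ties in \<open>f\<close> are broken by an enumeration \<open>g\<close> of
  \<open>A\<close> with values below \<open>N\<close>: the key \<open>f a * N + g a\<close> is
  lexicographic. Injectivity makes minimisers of the key unique, so that two different searches for
  a smallest member can be shown to agree.\<close>

lemma obtain_injective_key:
  fixes f :: "'i \<Rightarrow> nat"
  assumes "finite A"
  obtains key :: "'i \<Rightarrow> nat" where "inj_on key A"
    "\<And>a b. \<lbrakk>a \<in> A; b \<in> A; key a \<le> key b\<rbrakk> \<Longrightarrow> f a \<le> f b"
proof -
  obtain g :: "'i \<Rightarrow> nat" and N where g: "g ` A = {i. i < N}" "inj_on g A"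
    using finite_imp_inj_to_nat_seg[OF assms] by metis
  have lt: "g a < N" if "a \<in> A" for a using g that by auto
  have mono: "f a \<le> f b" if "a \<in> A" "b \<in> A" "f a * N + g a \<le> f b * N + g b" for a b
  proof (rule ccontr)
    assume "\<not> f a \<le> f b"
    hence "(f b + 1) * N \<le> f a * N" by (intro mult_right_mono) auto
    thus False using that lt[of a] lt[of b] by auto
  qed
  show thesis
  proof (rule that[of "\<lambda>a. f a * N + g a"])
    show "inj_on (\<lambda>a. f a * N + g a) A"
    proof (rule inj_onI)
      fix a b assume ab: "a \<in> A" "b \<in> A" "f a * N + g a = f b * N + g b"
      have "f a = f b" using mono[of a b] mono[of b a] ab by auto
      thus "a = b" using ab g(2) by (auto dest: inj_onD)
    qed
  qed (use mono in auto)
qed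

text \<open>For integral \<open>q\<close>, the weight \<open>q ^ card (X - W)\<close> counts the
  colourings of \<open>X\<close> by \<open>q + 1\<close> colours in which \<open>W\<close> is the
  class of one fixed colour. The proof bounds an exponential moment: with
  \<open>t = card (T W a)\<close> and \<open>l\<close> the size of the chosen \<open>S b\<close>,
  the weighted average of \<open>exp (2 * t - l)\<close> over \<open>W\<close> and \<open>a\<close>
  is at most 1. As \<open>l \<le> card (S a)\<close> and \<open>1 + x \<le> exp x\<close>, the
  average of \<open>2 * t\<close> is at most that of \<open>card (S a)\<close>.\<close>

lemma spread_one_round:
  fixes S :: "'i \<Rightarrow> 'a set" and q R :: real
  assumes X: "finite X" and A: "finite A"
    and SPow: "S ` A \<subseteq> Pow X" and spr: "spread R A S" and q: "0 \<le> q" "8 * q \<le> R"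
  shows "\<exists>T. (\<forall>W a. W \<subseteq> X \<longrightarrow> a \<in> A \<longrightarrow> T W a \<subseteq> S a - W \<and> (\<exists>b\<in>A. S b \<subseteq> W \<union> T W a)) \<and>
    2 * (\<Sum>W\<in>Pow X. q ^ card (X - W) * (\<Sum>a\<in>A. real (card (T W a))))
       \<le> (q + 1) ^ card X * (\<Sum>a\<in>A. real (card (S a)))"
proof -
  have SX: "S a \<subseteq> X" if "a \<in> A" for a using SPow that by auto
  obtain key :: "'i \<Rightarrow> nat" where key: "inj_on key A"
    "\<And>a b. \<lbrakk>a \<in> A; b \<in> A; key a \<le> key b\<rbrakk> \<Longrightarrow> card (S a) \<le> card (S b)"
    using obtain_injective_key[OF A, of "\<lambda>a. card (S a)"] by metis
  \<comment> \<open>The value is arbitrary when no member lies inside \<open>U\<close>; wherever it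
    matters below, \<open>U\<close> contains a member.\<close>
  define b where "b U = (ARG_MIN key a. a \<in> A \<and> S a \<subseteq> U)" for U
  have b: "b U \<in> A" "S (b U) \<subseteq> U" "key (b U) \<le> key a"
    if "a \<in> A" "S a \<subseteq> U" for a U
    using arg_min_nat_lemma[of "\<lambda>a. a \<in> A \<and> S a \<subseteq> U" a key] that
    by (auto simp: b_def)
  define T where "T W a = S (b (W \<union> S a)) - W" for W a
  have T1: "T W a \<subseteq> S a - W" if "a \<in> A" for W a
    using b(2)[of a "W \<union> S a"] that by (auto simp: T_def)
  have T2: "b (W \<union> S a) \<in> A" "S (b (W \<union> S a)) \<subseteq> W \<union> T W a" if "a \<in> A" for W a
    using b(1)[of a "W \<union> S a"] that by (auto simp: T_def)
  text \<open>Since the injective key breaks ties, \<open>W \<union> T W a\<close> alone determines the chosen member \<open>S b\<close>;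
    hence at most \<open>2 ^ card (S b)\<close> different sets \<open>T W a\<close> lead to the same union.\<close>
  have bZ: "b (W \<union> T W a) = b (W \<union> S a)" if a: "a \<in> A" for W a
  proof -
    let ?Z = "W \<union> T W a" and ?U = "W \<union> S a"
    have 1: "key (b ?Z) \<le> key (b ?U)" "b ?Z \<in> A" "S (b ?Z) \<subseteq> ?Z"
      using b[of "b ?U" ?Z] T2[OF a] by auto
    hence "S (b ?Z) \<subseteq> ?U" using T1[OF a, of W] by auto
    hence "key (b ?U) \<le> key (b ?Z)" using b(3)[of "b ?Z" ?U] 1 by auto
    thus ?thesis using 1 T2(1)[OF a] key(1) by (auto dest: inj_onD)
  qed
  define w where "w W = q ^ card (X - W)" for W
  define l where "l Z = real (card (S (b Z)))" for Z
  define t where "t W a = real (card (T W a))" for W a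
  have w0: "w W \<ge> 0" for W using q by (auto simp: w_def)
  have R0: "R \<ge> 0" using q by auto
  have finS: "finite (S a)" if "a \<in> A" for a using SX[OF that] X finite_subset by auto
  \<comment> \<open>The constant 8 in \<open>8 * q \<le> R\<close> comes from here. Adding the
    points of \<open>T W a\<close> to \<open>W\<close> costs a factor \<open>q\<close> per point in
    the weight, the moment costs a factor \<open>exp 2\<close> per point, and spreadness pays for
    \<open>R\<close> per point.\<close>
  have e8: "exp 2 \<le> (8::real)"
  proof -
    have "exp (2::real) = exp (1/16) ^ 32" by (simp flip: exp_of_nat_mult)
    also have "\<dots> \<le> (1 + 1/16 + (1/16)\<^sup>2) ^ 32" by (intro power_mono exp_bound) auto
    also have "\<dots> \<le> 8" by (simp add: power2_eq_square power_divide)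
    finally show ?thesis .
  qed
  \<comment> \<open>\<open>Z\<close> stands for \<open>W \<union> T W a\<close> and \<open>Y\<close>
    for \<open>T W a\<close>; the pair \<open>(W, a)\<close> is recovered as
    \<open>(Z - Y, a)\<close>. Here \<open>Y \<subseteq> S (b Z)\<close> because \<open>b Z\<close>
    is also the member chosen for \<open>W \<union> S a\<close>.\<close>
  let ?D = "SIGMA Z:{Z \<in> Pow X. \<exists>a\<in>A. S a \<subseteq> Z}. SIGMA Y:Pow (S (b Z)). {a \<in> A. Y \<subseteq> S a}"
  have finD: "finite ?D"
  proof (intro finite_SigmaI)
    fix Z assume "Z \<in> {Z \<in> Pow X. \<exists>a\<in>A. S a \<subseteq> Z}"
    then obtain a where "a \<in> A" "S a \<subseteq> Z" by auto
    thus "finite (Pow (S (b Z)))" using finS b(1) by auto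
  qed (use X A in auto)
  have "(\<Sum>(W, a)\<in>Pow X \<times> A. w W * exp (2 * t W a - l (W \<union> S a)))
     \<le> (\<Sum>(Z, Y, a)\<in>?D. w Z * R ^ card Y * exp (- l Z))"
  proof (rule sum_le_included[where i = "\<lambda>(Z, Y, a). (Z - Y, a)"])
    show "finite (Pow X \<times> A)" using X A by auto
    show "finite ?D" by (rule finD)
    show "\<forall>y\<in>?D. 0 \<le> (case y of (Z, Y, a) \<Rightarrow> w Z * R ^ card Y * exp (- l Z))"
      using w0 R0 by auto
    show "\<forall>x\<in>Pow X \<times> A. \<exists>y\<in>?D. (case y of (Z, Y, a) \<Rightarrow> (Z - Y, a)) = x \<and>
        (case x of (W, a) \<Rightarrow> w W * exp (2 * t W a - l (W \<union> S a)))
          \<le> (case y of (Z, Y, a) \<Rightarrow> w Z * R ^ card Y * exp (- l Z))"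
    proof
      fix x assume "x \<in> Pow X \<times> A"
      then obtain W a where x: "x = (W, a)" "W \<subseteq> X" "a \<in> A" by auto
      let ?Z = "W \<union> T W a"
      have TX: "T W a \<subseteq> X - W" using T1[of a W] SX x by blast
      hence fT: "finite (T W a)" using X finite_subset by blast
      have "X - W = (X - ?Z) \<union> T W a" using TX by auto
      hence "card (X - W) = card (X - ?Z) + card (T W a)"
        using X TX fT by (subst card_Un_disjoint[symmetric]) auto
      hence wW: "w W = w ?Z * q ^ card (T W a)" by (simp add: w_def power_add)
      have "q ^ card (T W a) * exp (2 * t W a) = (q * exp 2) ^ card (T W a)"
        by (simp add: power_mult_distrib t_def flip: exp_of_nat2_mult)
      also have "\<dots> \<le> R ^ card (T W a)"
      proof (rule power_mono)
        have "q * exp 2 \<le> q * 8" using e8 q by (intro mult_left_mono) auto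
        thus "q * exp 2 \<le> R" using q by simp
      qed (use q in auto)
      finally have le: "q ^ card (T W a) * exp (2 * t W a) \<le> R ^ card (T W a)" .
      have "w W * exp (2 * t W a - l (W \<union> S a))
          = w ?Z * (q ^ card (T W a) * exp (2 * t W a)) * exp (- l ?Z)"
        by (simp add: wW exp_diff exp_minus field_simps l_def bZ[OF x(3)])
      also have "\<dots> \<le> w ?Z * R ^ card (T W a) * exp (- l ?Z)"
        using le w0 by (intro mult_right_mono mult_left_mono) auto
      finally have "w W * exp (2 * t W a - l (W \<union> S a)) \<le> \<dots>" .
      moreover have "T W a \<subseteq> S (b ?Z)" unfolding bZ[OF x(3)] by (auto simp: T_def)
      hence "(?Z, T W a, a) \<in> ?D"
        using T1[of a W] T2[of a W] x TX by auto
      moreover have "?Z - T W a = W" using TX by auto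
      ultimately show "\<exists>y\<in>?D. (case y of (Z, Y, a) \<Rightarrow> (Z - Y, a)) = x \<and>
          (case x of (W, a) \<Rightarrow> w W * exp (2 * t W a - l (W \<union> S a)))
            \<le> (case y of (Z, Y, a) \<Rightarrow> w Z * R ^ card Y * exp (- l Z))"
        using x by (intro bexI[of _ "(?Z, T W a, a)"]) auto
    qed
  qed
  also have "\<dots> = (\<Sum>Z\<in>{Z \<in> Pow X. \<exists>a\<in>A. S a \<subseteq> Z}.
       \<Sum>Y\<in>Pow (S (b Z)). \<Sum>a\<in>{a \<in> A. Y \<subseteq> S a}. w Z * R ^ card Y * exp (- l Z))"
  proof -
    have "(\<Sum>Y\<in>Pow (S (b Z)). \<Sum>a\<in>{a \<in> A. Y \<subseteq> S a}. w Z * R ^ card Y * exp (- l Z))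
       = (\<Sum>(Y, a)\<in>(SIGMA Y:Pow (S (b Z)). {a \<in> A. Y \<subseteq> S a}). w Z * R ^ card Y * exp (- l Z))"
      if "Z \<in> {Z \<in> Pow X. \<exists>a\<in>A. S a \<subseteq> Z}" for Z
      using that finS b(1) A by (intro sum.Sigma) auto
    hence "(\<Sum>Z\<in>{Z \<in> Pow X. \<exists>a\<in>A. S a \<subseteq> Z}.
       \<Sum>Y\<in>Pow (S (b Z)). \<Sum>a\<in>{a \<in> A. Y \<subseteq> S a}. w Z * R ^ card Y * exp (- l Z))
      = (\<Sum>Z\<in>{Z \<in> Pow X. \<exists>a\<in>A. S a \<subseteq> Z}.
          \<Sum>(Y, a)\<in>(SIGMA Y:Pow (S (b Z)). {a \<in> A. Y \<subseteq> S a}). w Z * R ^ card Y * exp (- l Z))"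
      by (intro sum.cong) auto
    also have "\<dots> = (\<Sum>(Z, Y, a)\<in>?D. w Z * R ^ card Y * exp (- l Z))"
      using X finS b(1) A by (subst sum.Sigma) (auto intro!: sum.cong)
    finally show ?thesis by simp
  qed
  \<comment> \<open>For fixed \<open>Z\<close>, spreadness bounds the contribution of each
    \<open>Y\<close> by \<open>card A\<close>, and \<open>exp (- l Z)\<close> outweighs the
    \<open>2 ^ card (S (b Z))\<close> choices of \<open>Y\<close>.\<close>
  also have "\<dots> \<le> (\<Sum>Z\<in>{Z \<in> Pow X. \<exists>a\<in>A. S a \<subseteq> Z}. w Z * real (card A))"
  proof (rule sum_mono)
    fix Z assume "Z \<in> {Z \<in> Pow X. \<exists>a\<in>A. S a \<subseteq> Z}"
    hence fb: "finite (S (b Z))" using finS b(1) by auto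
    have "(\<Sum>Y\<in>Pow (S (b Z)). \<Sum>a\<in>{a \<in> A. Y \<subseteq> S a}. w Z * R ^ card Y * exp (- l Z))
        = w Z * exp (- l Z) * (\<Sum>Y\<in>Pow (S (b Z)). real (card {a \<in> A. Y \<subseteq> S a}) * R ^ card Y)"
      by (simp add: sum_distrib_left mult_ac)
    also have "\<dots> \<le> w Z * exp (- l Z) * (\<Sum>Y\<in>Pow (S (b Z)). real (card A))"
      using spr w0 fb finite_subset
      by (intro mult_left_mono sum_mono mult_nonneg_nonneg) (auto simp: spread_def)
    also have "\<dots> = w Z * real (card A) * (exp (- l Z) * 2 ^ card (S (b Z)))"
      using fb by (simp add: card_Pow)
    also have "\<dots> \<le> w Z * real (card A) * 1"
    proof (intro mult_left_mono)
      have "(2::real) ^ card (S (b Z)) \<le> exp 1 ^ card (S (b Z))"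
        using exp_ge_add_one_self[of 1] by (intro power_mono) auto
      also have "\<dots> = exp (l Z)" by (simp add: l_def flip: exp_of_nat_mult)
      finally show "exp (- l Z) * 2 ^ card (S (b Z)) \<le> 1"
        by (simp add: exp_minus field_simps)
    qed (use w0 in auto)
    finally show "(\<Sum>Y\<in>Pow (S (b Z)). \<Sum>a\<in>{a \<in> A. Y \<subseteq> S a}. w Z * R ^ card Y * exp (- l Z))
        \<le> w Z * real (card A)" by simp
  qed
  also have "\<dots> \<le> (\<Sum>Z\<in>Pow X. w Z * real (card A))"
    using X w0 by (intro sum_mono2) auto
  also have "\<dots> = (\<Sum>(W, a)\<in>Pow X \<times> A. w W)"
    by (simp add: sum.cartesian_product[symmetric] mult.commute)
  finally have main: "(\<Sum>(W, a)\<in>Pow X \<times> A. w W * exp (2 * t W a - l (W \<union> S a)))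
     \<le> (\<Sum>(W, a)\<in>Pow X \<times> A. w W)" .
  have "(\<Sum>(W, a)\<in>Pow X \<times> A. w W * (1 + (2 * t W a - card (S a))))
     \<le> (\<Sum>(W, a)\<in>Pow X \<times> A. w W * exp (2 * t W a - l (W \<union> S a)))"
  proof (rule sum_mono, clarify)
    fix W a assume "W \<subseteq> X" "a \<in> A"
    have "l (W \<union> S a) \<le> card (S a)"
      unfolding l_def using b[of a "W \<union> S a"] key(2)[of "b (W \<union> S a)" a] \<open>a \<in> A\<close> by auto
    moreover have "1 + (2 * t W a - l (W \<union> S a)) \<le> exp (2 * t W a - l (W \<union> S a))"
      by (rule exp_ge_add_one_self)
    ultimately have "1 + (2 * t W a - card (S a)) \<le> exp (2 * t W a - l (W \<union> S a))" by linarith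
    thus "w W * (1 + (2 * t W a - card (S a))) \<le> w W * exp (2 * t W a - l (W \<union> S a))"
      using w0 by (intro mult_left_mono)
  qed
  with main have "(\<Sum>(W, a)\<in>Pow X \<times> A. w W * (1 + (2 * t W a - card (S a))))
     \<le> (\<Sum>(W, a)\<in>Pow X \<times> A. w W)" by linarith
  hence "2 * (\<Sum>W\<in>Pow X. \<Sum>a\<in>A. w W * t W a) \<le> (\<Sum>W\<in>Pow X. \<Sum>a\<in>A. w W * real (card (S a)))"
    by (simp add: sum.cartesian_product[symmetric] algebra_simps sum.distrib sum_subtractf sum_distrib_left)
  also have "\<dots> = (\<Sum>W\<in>Pow X. w W) * (\<Sum>a\<in>A. real (card (S a)))"
    by (simp add: sum_product)
  also have "(\<Sum>W\<in>Pow X. w W) = (q + 1) ^ card X"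
    unfolding w_def by (rule sum_Pow_power_card_diff[OF X])
  finally have "2 * (\<Sum>W\<in>Pow X. q ^ card (X - W) * (\<Sum>a\<in>A. real (card (T W a))))
       \<le> (q + 1) ^ card X * (\<Sum>a\<in>A. real (card (S a)))"
    by (simp add: sum_distrib_left w_def t_def)
  moreover have "\<forall>W a. W \<subseteq> X \<longrightarrow> a \<in> A \<longrightarrow> T W a \<subseteq> S a - W \<and> (\<exists>b\<in>A. S b \<subseteq> W \<union> T W a)"
    using T1 T2 by blast
  ultimately show ?thesis by (intro exI[of _ T] conjI)
qed

section \<open>Iterated exposure of colours, and disjoint members of spread families\<close>

lemma spread_colouring_count:
  fixes S :: "'i \<Rightarrow> 'a set" and J K :: "'c set" and R :: real
  assumes "finite J" "J \<subseteq> K" "finite K" "finite X" "finite A" "A \<noteq> {}"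
    "\<And>a. a \<in> A \<Longrightarrow> S a \<subseteq> X" "spread R A S" "8 * real (card K) \<le> R"
  shows "real (card {\<chi> \<in> X \<rightarrow>\<^sub>E K. \<not> (\<exists>a\<in>A. S a \<subseteq> \<chi> -` J)}) * (real (card A) * 2 ^ card J)
           \<le> real (card K) ^ card X * (\<Sum>a\<in>A. real (card (S a)))"
  using assms
\<comment> \<open>One colour \<open>c\<close> of \<open>J\<close> is exposed per step. With
  \<open>W\<close> its class, the colouring continues on \<open>X - W\<close> with the colours
  \<open>K - {c}\<close> and the sets \<open>T W a\<close>, which is why \<open>K\<close>,
  \<open>X\<close> and \<open>S\<close> vary. Each step gains the factor 2 of
  \<open>spread_one_round\<close>. For empty \<open>J\<close> a bad colouring exists only if every
  \<open>S a\<close> is nonempty, and then the total size is at least \<open>card A\<close>.\<close>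
proof (induction J arbitrary: K X S rule: finite_induct)
  case empty
  show ?case
  proof (cases "\<exists>a\<in>A. S a = {}")
    case True
    hence eq: "{\<chi> \<in> X \<rightarrow>\<^sub>E K. \<not> (\<exists>a\<in>A. S a \<subseteq> \<chi> -` {})} = {}" by auto
    show ?thesis unfolding eq by (auto intro!: mult_nonneg_nonneg sum_nonneg)
  next
    case False
    have "card {\<chi> \<in> X \<rightarrow>\<^sub>E K. \<not> (\<exists>a\<in>A. S a \<subseteq> \<chi> -` {})} \<le> card (X \<rightarrow>\<^sub>E K)"
      using empty by (intro card_mono finite_PiE) auto
    also have "\<dots> = card K ^ card X" using empty by (simp add: card_PiE)
    finally have "real (card {\<chi> \<in> X \<rightarrow>\<^sub>E K. \<not> (\<exists>a\<in>A. S a \<subseteq> \<chi> -` {})}) \<le> real (card K ^ card X)"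
      by (simp only: of_nat_le_iff)
    hence 1: "real (card {\<chi> \<in> X \<rightarrow>\<^sub>E K. \<not> (\<exists>a\<in>A. S a \<subseteq> \<chi> -` {})}) \<le> real (card K) ^ card X"
      by simp
    have "(\<Sum>a\<in>A. 1) \<le> (\<Sum>a\<in>A. real (card (S a)))"
    proof (rule sum_mono)
      fix a assume a: "a \<in> A"
      hence "finite (S a)" using empty finite_subset by blast
      hence "card (S a) \<noteq> 0" using False a by auto
      thus "1 \<le> real (card (S a))" by simp
    qed
    hence "real (card A) \<le> (\<Sum>a\<in>A. real (card (S a)))" by simp
    thus ?thesis using 1 by (auto intro!: mult_mono)
  qed
next
  case (insert c J)
  define q where "q = real (card (K - {c}))"
  have cK: "c \<in> K" using insert by auto
  have q1: "q + 1 = real (card K)"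
    unfolding q_def using card.remove[OF insert.prems(2) cK] by linarith
  have q8: "0 \<le> q" "8 * q \<le> R" using q1 insert.prems by (auto simp: q_def)
  have R0: "R \<ge> 0" using q8 by linarith
  have "S ` A \<subseteq> Pow X" using insert.prems(6) by auto
  from spread_one_round[OF insert.prems(3,4) this insert.prems(7) q8]
  obtain T where T0: "\<forall>W a. W \<subseteq> X \<longrightarrow> a \<in> A \<longrightarrow> T W a \<subseteq> S a - W \<and> (\<exists>b\<in>A. S b \<subseteq> W \<union> T W a)"
    and T3: "2 * (\<Sum>W\<in>Pow X. q ^ card (X - W) * (\<Sum>a\<in>A. real (card (T W a))))
       \<le> (q + 1) ^ card X * (\<Sum>a\<in>A. real (card (S a)))"
    by (elim exE conjE)
  have T: "T W a \<subseteq> S a - W" "\<exists>b\<in>A. S b \<subseteq> W \<union> T W a" if "W \<subseteq> X" "a \<in> A" for W a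
    using T0 that by blast+
  define B where "B W = {\<chi> \<in> (X - W) \<rightarrow>\<^sub>E (K - {c}). \<not> (\<exists>a\<in>A. T W a \<subseteq> \<chi> -` J)}" for W
  let ?B = "{\<chi> \<in> X \<rightarrow>\<^sub>E K. \<not> (\<exists>a\<in>A. S a \<subseteq> \<chi> -` (insert c J))}"
  let ?m = "real (card A) * 2 ^ card J"
  have IH: "real (card (B W)) * ?m \<le> q ^ card (X - W) * (\<Sum>a\<in>A. real (card (T W a)))"
    if W: "W \<subseteq> X" for W
    unfolding B_def q_def
  proof (rule insert.IH)
    show "T W a \<subseteq> X - W" if "a \<in> A" for a using T(1)[OF W that] insert.prems(6)[OF that] by auto
    show "spread R A (T W)"
      by (rule spread_subset[OF insert.prems(7,4) R0]) (use T(1)[OF W] in auto)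
    show "8 * real (card (K - {c})) \<le> R" using q8 by (simp add: q_def)
  qed (use insert in auto)
  have finB: "finite (B W)" for W
    unfolding B_def
    by (rule finite_subset[of _ "(X - W) \<rightarrow>\<^sub>E (K - {c})"])
       (use insert.prems(2,3) in \<open>auto intro: finite_PiE\<close>)
  \<comment> \<open>A colouring is split into the class \<open>W\<close> of \<open>c\<close> and its
    restriction to \<open>X - W\<close>. If the restriction coloured some \<open>T W a\<close> from
    \<open>J\<close>, a member \<open>S b \<subseteq> W \<union> T W a\<close> would be coloured
    from \<open>insert c J\<close>; hence a bad colouring restricts to an element of
    \<open>B W\<close>.\<close>
  define \<phi> where "\<phi> \<chi> = ({x \<in> X. \<chi> x = c}, restrict \<chi> (X - {x \<in> X. \<chi> x = c}))" for \<chi> :: "'a \<Rightarrow> 'c"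
  have inj: "inj_on \<phi> ?B"
  proof (rule inj_onI)
    fix \<chi> \<psi> assume a: "\<chi> \<in> ?B" "\<psi> \<in> ?B" "\<phi> \<chi> = \<phi> \<psi>"
    have "fst (\<phi> \<chi>) = fst (\<phi> \<psi>)" "snd (\<phi> \<chi>) = snd (\<phi> \<psi>)" using a(3) by simp_all
    hence W: "{x \<in> X. \<chi> x = c} = {x \<in> X. \<psi> x = c}"
      and r: "restrict \<chi> (X - {x \<in> X. \<chi> x = c}) = restrict \<psi> (X - {x \<in> X. \<psi> x = c})"
      by (simp_all only: \<phi>_def fst_conv snd_conv)
    show "\<chi> = \<psi>"
    proof (rule PiE_ext)
      show "\<chi> \<in> X \<rightarrow>\<^sub>E K" "\<psi> \<in> X \<rightarrow>\<^sub>E K" using a(1,2) by simp_all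
      fix x assume x: "x \<in> X"
      have "\<chi> x = c \<longleftrightarrow> \<psi> x = c" using W x by blast
      thus "\<chi> x = \<psi> x" using fun_cong[OF r, of x] x by (cases "\<chi> x = c") simp_all
    qed
  qed
  have sub: "\<phi> ` ?B \<subseteq> (SIGMA W:Pow X. B W)"
  proof clarify
    fix \<chi> W \<psi> assume a: "\<chi> \<in> X \<rightarrow>\<^sub>E K" "\<not> (\<exists>a\<in>A. S a \<subseteq> \<chi> -` insert c J)" "(W, \<psi>) = \<phi> \<chi>"
    have W: "W = {x \<in> X. \<chi> x = c}"
      using arg_cong[OF a(3), of fst] by (simp only: \<phi>_def fst_conv)
    have \<psi>: "\<psi> = restrict \<chi> (X - W)"
      using arg_cong[OF a(3), of snd] unfolding W by (simp only: \<phi>_def snd_conv)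
    have WX: "W \<subseteq> X" using W by auto
    have "\<not> T W x \<subseteq> \<psi> -` J" if x: "x \<in> A" for x
    proof
      assume sub: "T W x \<subseteq> \<psi> -` J"
      obtain b where b: "b \<in> A" "S b \<subseteq> W \<union> T W x" using T(2)[OF WX x] by auto
      \<comment> \<open>Outside \<open>X - W\<close> the map \<open>\<psi>\<close> has the default
        value \<open>undefined\<close>, which might lie in \<open>J\<close>; so the transfer from
        \<open>\<psi>\<close> to \<open>\<chi>\<close> needs this inclusion.\<close>
      have "T W x \<subseteq> X - W" using T(1)[OF WX x] insert.prems(6)[OF x] by auto
      hence "T W x \<subseteq> \<chi> -` J" using sub by (auto simp: \<psi> subset_iff)
      hence "S b \<subseteq> \<chi> -` insert c J" using b(2) W by auto
      thus False using a(2) b(1) by auto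
    qed
    moreover have "\<psi> \<in> (X - W) \<rightarrow>\<^sub>E (K - {c})" using a(1) by (auto simp: \<psi> W)
    ultimately show "W \<in> Pow X \<and> \<psi> \<in> B W" using WX by (auto simp: B_def)
  qed
  have "card ?B \<le> card (SIGMA W:Pow X. B W)"
    using insert.prems(3) finB by (intro card_inj_on_le[OF inj sub] finite_SigmaI) auto
  also have "\<dots> = (\<Sum>W\<in>Pow X. card (B W))"
    using insert.prems(3) finB by (intro card_SigmaI) auto
  finally have "real (card ?B) \<le> (\<Sum>W\<in>Pow X. real (card (B W)))"
    by (simp only: of_nat_le_iff flip: of_nat_sum)
  hence "real (card ?B) * ?m \<le> (\<Sum>W\<in>Pow X. real (card (B W))) * ?m"
    by (intro mult_right_mono) auto
  also have "\<dots> \<le> (\<Sum>W\<in>Pow X. q ^ card (X - W) * (\<Sum>a\<in>A. real (card (T W a))))"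
    unfolding sum_distrib_right by (intro sum_mono IH) auto
  finally have "2 * (real (card ?B) * ?m) \<le> (q + 1) ^ card X * (\<Sum>a\<in>A. real (card (S a)))"
    using T3 by linarith
  thus ?case using insert.hyps by (simp add: q1 mult_ac)
qed

text \<open>The colours are pairs of an index and a number below \<open>m\<close>, so every index
  owns \<open>m\<close> colours. By the preceding count, index \<open>i\<close> is bad for at most a
  fraction \<open>k / 2 ^ m\<close> of the colourings, and these fractions add up to less than 1. In
  a colouring that is good for all indices the chosen sets use disjoint sets of colours.\<close>

lemma spread_disjoint_members:
  fixes S :: "'j \<Rightarrow> 'i \<Rightarrow> 'a set" and R :: real
  assumes I: "finite I" and X: "finite X"
    and A: "\<And>i. i \<in> I \<Longrightarrow> finite (A i)" "\<And>i. i \<in> I \<Longrightarrow> A i \<noteq> {}"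
    and SX: "\<And>i a. \<lbrakk>i \<in> I; a \<in> A i\<rbrakk> \<Longrightarrow> S i a \<subseteq> X"
    and Sk: "\<And>i a. \<lbrakk>i \<in> I; a \<in> A i\<rbrakk> \<Longrightarrow> card (S i a) \<le> k"
    and spr: "\<And>i. i \<in> I \<Longrightarrow> spread R (A i) (S i)"
    and R: "8 * real (card I * m) \<le> R" and m: "m > 0" "card I * k < 2 ^ m"
  obtains a where "\<And>i. i \<in> I \<Longrightarrow> a i \<in> A i"
    "\<And>i j. \<lbrakk>i \<in> I; j \<in> I; i \<noteq> j\<rbrakk> \<Longrightarrow> S i (a i) \<inter> S j (a j) = {}"
proof (cases "I = {}")
  case True
  thus ?thesis using that by auto
next
  case False
  define K where "K = I \<times> {..<m}"
  define J where "J i = {i} \<times> {..<m}" for i :: 'j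
  have K: "finite K" "card K = card I * m" using I by (auto simp: K_def)
  have Kpos: "card K > 0" using K False m I by (auto simp: card_gt_0_iff)
  have J: "J i \<subseteq> K" "card (J i) = m" "finite (J i)" if "i \<in> I" for i
    using that by (auto simp: J_def K_def card_cartesian_product)
  define B where "B i = {\<chi> \<in> X \<rightarrow>\<^sub>E K. \<not> (\<exists>a\<in>A i. S i a \<subseteq> \<chi> -` J i)}" for i
  let ?N = "real (card K) ^ card X"
  have bad: "real (card (B i)) * 2 ^ m \<le> ?N * k" if i: "i \<in> I" for i
  proof -
    have "real (card (B i)) * (real (card (A i)) * 2 ^ card (J i)) \<le> ?N * (\<Sum>a\<in>A i. real (card (S i a)))"
      unfolding B_def
      by (rule spread_colouring_count) (use i J A SX spr R K X in auto)
    also have "\<dots> \<le> ?N * (\<Sum>a\<in>A i. real k)"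
      using Sk[OF i] by (intro mult_left_mono sum_mono) auto
    finally have "real (card (A i)) * (real (card (B i)) * 2 ^ m) \<le> real (card (A i)) * (?N * k)"
      using J(2)[OF i] by (simp add: mult_ac)
    moreover have "real (card (A i)) > 0" using A[OF i] by (simp add: card_gt_0_iff)
    ultimately show ?thesis by (simp only: mult_le_cancel_left_pos)
  qed
  have finP: "finite (X \<rightarrow>\<^sub>E K)" using X K by (intro finite_PiE) auto
  have "real (card (\<Union>i\<in>I. B i)) * 2 ^ m \<le> (\<Sum>i\<in>I. real (card (B i))) * 2 ^ m"
    using card_UN_le[OF I, of B] by (intro mult_right_mono) (auto simp flip: of_nat_sum)
  also have "\<dots> \<le> (\<Sum>i\<in>I. ?N * k)"
    unfolding sum_distrib_right by (intro sum_mono bad)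
  also have "\<dots> = ?N * real (card I * k)" by simp
  also have "\<dots> < ?N * 2 ^ m"
  proof (intro mult_strict_left_mono)
    show "real (card I * k) < 2 ^ m" using m(2) by (metis of_nat_less_iff of_nat_numeral of_nat_power)
  qed (use Kpos in auto)
  finally have "real (card (\<Union>i\<in>I. B i)) < ?N" by simp
  also have "?N = real (card (X \<rightarrow>\<^sub>E K))" using X by (simp add: card_PiE)
  finally have "\<not> (X \<rightarrow>\<^sub>E K) \<subseteq> (\<Union>i\<in>I. B i)"
    using card_mono[of "\<Union>i\<in>I. B i" "X \<rightarrow>\<^sub>E K"] I finP
    by (auto simp: B_def)
  then obtain \<chi> where "\<chi> \<in> X \<rightarrow>\<^sub>E K" "\<chi> \<notin> (\<Union>i\<in>I. B i)" by blast
  hence "\<exists>a\<in>A i. S i a \<subseteq> \<chi> -` J i" if "i \<in> I" for i using that by (auto simp: B_def)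
  then obtain a where a: "\<And>i. i \<in> I \<Longrightarrow> a i \<in> A i" "\<And>i. i \<in> I \<Longrightarrow> S i (a i) \<subseteq> \<chi> -` J i"
    by metis
  show ?thesis
  proof (rule that[OF a(1)])
    fix i j assume "i \<in> I" "j \<in> I" "i \<noteq> j"
    thus "S i (a i) \<inter> S j (a j) = {}" using a(2)[of i] a(2)[of j] by (fastforce simp: J_def)
  qed
qed

section \<open>Tuples through a given set, and kernels of set families\<close>

lemma finite_tuples: "finite (tuples n k)"
  by (auto simp: tuples_def intro: finite_PiE)

lemma finite_tuple_set: "finite (tuple_set k x)"
proof -
  have "tuple_set k x = (\<lambda>j. (j, x j)) ` {1..k}" by (auto simp: tuple_set_def)
  thus ?thesis by simp
qed

lemma card_tuple_set: "card (tuple_set k x) = k"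
proof -
  have "tuple_set k x = (\<lambda>j. (j, x j)) ` {1..k}" by (auto simp: tuple_set_def)
  thus ?thesis by (simp add: card_image inj_on_def)
qed

lemma tuple_set_subset: "x \<in> tuples n k \<Longrightarrow> tuple_set k x \<subseteq> {1..k} \<times> {1..n}"
  by (auto simp: tuple_set_def tuples_def PiE_iff)

lemma card_tuples_containing:
  "card {x \<in> tuples n k. T \<subseteq> tuple_set k x} * n ^ card T \<le> n ^ k"
proof (cases "{x \<in> tuples n k. T \<subseteq> tuple_set k x} = {}")
  case False
  then obtain y where y: "y \<in> tuples n k" "T \<subseteq> tuple_set k y" by auto
  let ?F = "{x \<in> tuples n k. T \<subseteq> tuple_set k x}"
  let ?D = "fst ` T"
  have D: "?D \<subseteq> {1..k}" using y(2) by (auto simp: tuple_set_def)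
  have "snd p = y (fst p)" if "p \<in> T" for p using that y(2) by (auto simp: tuple_set_def)
  hence cD: "card ?D = card T" by (intro card_image inj_onI prod_eqI) auto
  have agree: "x j = y j" if "x \<in> ?F" "j \<in> ?D" for x j
  proof -
    obtain z where "(j, z) \<in> T" using \<open>j \<in> ?D\<close> by auto
    thus ?thesis using that(1) y(2) by (auto simp: tuple_set_def)
  qed
  have "card ?F \<le> card (({1..k} - ?D) \<rightarrow>\<^sub>E {1..n})"
  proof (rule card_inj_on_le)
    show "inj_on (\<lambda>x. restrict x ({1..k} - ?D)) ?F"
    proof (rule inj_onI)
      fix x z assume xz: "x \<in> ?F" "z \<in> ?F"
        "restrict x ({1..k} - ?D) = restrict z ({1..k} - ?D)"
      show "x = z"
      proof (rule PiE_ext)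
        show "x \<in> {1..k} \<rightarrow>\<^sub>E {1..n}" "z \<in> {1..k} \<rightarrow>\<^sub>E {1..n}" using xz by (auto simp: tuples_def)
        fix j assume "j \<in> {1..k}"
        thus "x j = z j"
          using agree[OF xz(1), of j] agree[OF xz(2), of j] fun_cong[OF xz(3), of j]
          by (cases "j \<in> ?D") auto
      qed
    qed
    show "(\<lambda>x. restrict x ({1..k} - ?D)) ` ?F \<subseteq> ({1..k} - ?D) \<rightarrow>\<^sub>E {1..n}"
      by (force simp: tuples_def restrict_PiE_iff dest: PiE_mem)
  qed (auto intro: finite_PiE)
  also have "\<dots> = n ^ (k - card T)"
    using D cD by (simp add: card_PiE card_Diff_subset finite_subset[OF D])
  finally have "card ?F * n ^ card T \<le> n ^ (k - card T) * n ^ card T" by simp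
  also have "\<dots> = n ^ k"
    using cD card_mono[OF _ D] by (simp flip: power_add)
  finally show ?thesis .
next
  case True
  show ?thesis unfolding True by simp
qed

text \<open>The spread family \<open>G\<close> is some subfamily through \<open>Q\<close>, not
  necessarily all of it. This makes the notion monotone in \<open>F\<close>, so that a kernel found
  in a remaining part of a family is a kernel of the family.\<close>

definition kernel :: "real \<Rightarrow> 'i set \<Rightarrow> ('i \<Rightarrow> 'a set) \<Rightarrow> 'a set \<Rightarrow> bool" where
  "kernel R F E Q \<longleftrightarrow>
     (\<exists>G\<subseteq>F. G \<noteq> {} \<and> (\<forall>x\<in>G. Q \<subseteq> E x) \<and> spread R G (\<lambda>x. E x - Q))"

text \<open>\<open>Q\<close> maximises \<open>f\<close> over the subsets of the union of all
  \<open>E x\<close>. Comparison with \<open>Q \<union> T\<close>, for \<open>T\<close> disjoint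
  from \<open>Q\<close>, gives spreadness after cancelling \<open>R ^ card Q\<close>; comparison
  with the empty set gives the size bound. A set \<open>T\<close> that meets \<open>Q\<close> or
  leaves the union lies in no \<open>E x - Q\<close>.\<close>

lemma obtain_kernel:
  fixes E :: "'i \<Rightarrow> 'a set" and R :: real
  assumes F: "finite F" "F \<noteq> {}" and E: "\<And>x. x \<in> F \<Longrightarrow> finite (E x)" and R: "R > 0"
  obtains Q where "kernel R F E Q" "real (card F) \<le> real (card {x \<in> F. Q \<subseteq> E x}) * R ^ card Q"
proof -
  define f where "f Q = real (card {x \<in> F. Q \<subseteq> E x}) * R ^ card Q" for Q
  let ?P = "Pow (\<Union>x\<in>F. E x)"
  have finP: "finite ?P" using F E by auto
  have "Max (f ` ?P) \<in> f ` ?P" by (rule Max_in) (use finP in auto)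
  then obtain Q where Q: "Q \<in> ?P" "f Q = Max (f ` ?P)" by auto
  have max: "f T \<le> f Q" if "T \<in> ?P" for T using finP that unfolding Q(2) by (intro Max_ge) auto
  have finQ: "finite Q" using Q(1) F E by (auto intro: finite_subset)
  let ?G = "{x \<in> F. Q \<subseteq> E x}"
  have "f {} = card F" by (simp add: f_def)
  hence big: "real (card F) \<le> f Q" using max[of "{}"] by simp
  have "card F > 0" using F by (simp add: card_gt_0_iff)
  hence "card ?G \<noteq> 0" using big unfolding f_def by (intro notI) simp
  hence "?G \<noteq> {}" by force
  moreover have "spread R ?G (\<lambda>x. E x - Q)"
    unfolding spread_def
  proof (intro allI impI)
    fix T :: "'a set" assume T: "finite T"
    let ?H = "{x \<in> ?G. T \<subseteq> E x - Q}"
    show "real (card ?H) * R ^ card T \<le> real (card ?G)"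
    proof (cases "?H = {}")
      case False
      hence TQ: "T \<inter> Q = {}" "Q \<union> T \<in> ?P" by auto
      have eq: "?H = {x \<in> F. Q \<union> T \<subseteq> E x}" using TQ(1) by auto
      have "f (Q \<union> T) \<le> f Q" by (rule max[OF TQ(2)])
      hence "(real (card ?H) * R ^ card T) * R ^ card Q \<le> real (card ?G) * R ^ card Q"
        unfolding eq f_def using TQ(1) finQ T
        by (subst (asm) card_Un_disjoint) (auto simp: power_add mult_ac)
      thus ?thesis using R by (simp only: mult_le_cancel_right_pos zero_less_power)
    qed (metis card.empty mult_zero_left of_nat_0 of_nat_0_le_iff)
  qed
  ultimately show thesis
    using big by (intro that[of Q]) (auto simp: kernel_def f_def intro!: exI[of _ ?G])
qed

lemma kernel_mono:
  assumes "kernel R F E Q" "F \<subseteq> F'"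
  shows "kernel R F' E Q"
proof -
  from assms(1) obtain G where "G \<subseteq> F" "G \<noteq> {} \<and> (\<forall>x\<in>G. Q \<subseteq> E x) \<and> spread R G (\<lambda>x. E x - Q)"
    unfolding kernel_def by (elim exE conjE) simp
  thus ?thesis unfolding kernel_def using assms(2) by (intro exI[of _ G]) simp
qed

lemma kernel_subset_member:
  assumes "kernel R F E Q"
  shows "\<exists>x\<in>F. Q \<subseteq> E x"
proof -
  from assms obtain G where G: "G \<subseteq> F" "G \<noteq> {}" "\<forall>x\<in>G. Q \<subseteq> E x"
    unfolding kernel_def by (elim exE conjE)
  from G(2) obtain x where "x \<in> G" by auto
  thus ?thesis using G(1,3) by auto
qed

section \<open>Selection of pairwise disjoint kernels\<close>

lemma distinct_representatives_exist:
  fixes V :: "nat \<Rightarrow> 'a set"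
  assumes "\<And>i. \<lbrakk>i \<in> I; i \<in> {1..m}\<rbrakk> \<Longrightarrow> finite (V i) \<and> i \<le> card (V i)"
  shows "\<exists>v. inj_on v (I \<inter> {1..m}) \<and> (\<forall>i\<in>I \<inter> {1..m}. v i \<in> V i)"
  using assms
proof (induction m)
  case (Suc m)
  then obtain v where v: "inj_on v (I \<inter> {1..m})" "\<forall>i\<in>I \<inter> {1..m}. v i \<in> V i" by fastforce
  show ?case
  proof (cases "Suc m \<in> I")
    case False
    hence "I \<inter> {1..Suc m} = I \<inter> {1..m}" by (auto simp: le_Suc_eq)
    thus ?thesis using v by auto
  next
    case True
    hence eq: "I \<inter> {1..Suc m} = insert (Suc m) (I \<inter> {1..m})" by (auto simp: le_Suc_eq)
    have V: "finite (V (Suc m))" "Suc m \<le> card (V (Suc m))" using Suc.prems[OF True] by auto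
    \<comment> \<open>The choice is greedy: earlier indices occupy at most \<open>m\<close> points,
      and \<open>V (Suc m)\<close> has at least \<open>Suc m\<close>.\<close>
    have "card (v ` (I \<inter> {1..m})) \<le> card (I \<inter> {1..m})" by (rule card_image_le) auto
    also have "\<dots> \<le> card {1..m}" by (intro card_mono) auto
    finally have "card (v ` (I \<inter> {1..m})) < card (V (Suc m))" using V by simp
    hence "\<not> V (Suc m) \<subseteq> v ` (I \<inter> {1..m})"
      using card_mono[of "v ` (I \<inter> {1..m})" "V (Suc m)"] by fastforce
    then obtain z where z: "z \<in> V (Suc m)" "z \<notin> v ` (I \<inter> {1..m})" by auto
    let ?v = "v(Suc m := z)"
    have im: "?v ` (I \<inter> {1..m}) = v ` (I \<inter> {1..m})" by (auto simp: image_iff)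
    have "inj_on ?v (I \<inter> {1..m})" using v(1) by (auto simp: inj_on_def)
    hence "inj_on ?v (I \<inter> {1..Suc m})"
      unfolding eq using z(2) im by (auto simp: inj_on_insert)
    moreover have "\<forall>i\<in>I \<inter> {1..Suc m}. ?v i \<in> V i"
      unfolding eq using v(2) z(1) by auto
    ultimately show ?thesis by blast
  qed
qed simp

text \<open>The sets \<open>V i\<close>, at most one point each, are reserved in advance: a set chosen for an earlier
  index must leave them free.\<close>

lemma disjoint_selection:
  fixes \<Q> :: "nat \<Rightarrow> 'a set set" and V :: "nat \<Rightarrow> 'a set"
  assumes Q2: "\<And>i Q. \<lbrakk>i \<in> {1..s}; Q \<in> \<Q> i\<rbrakk> \<Longrightarrow> finite Q \<and> card Q \<le> 2"
    and V1: "\<And>i. i \<in> {1..s} \<Longrightarrow> finite (V i) \<and> card (V i) \<le> 1"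
    and Vd: "\<And>i j. \<lbrakk>i \<in> {1..s}; j \<in> {1..s}; i \<noteq> j\<rbrakk> \<Longrightarrow> V i \<inter> V j = {}"
    and ex: "\<And>i U. \<lbrakk>i \<in> {1..s}; finite U; card U < 2 * s; U \<inter> V i = {}\<rbrakk>
               \<Longrightarrow> \<exists>Q\<in>\<Q> i. Q \<inter> U = {}"
    and "m \<le> s"
  shows "\<exists>Q. (\<forall>i\<in>{1..m}. Q i \<in> \<Q> i) \<and> (\<forall>i\<in>{1..m}. \<forall>j\<in>{1..m}. i \<noteq> j \<longrightarrow> Q i \<inter> Q j = {})
           \<and> (\<forall>i\<in>{1..m}. \<forall>j\<in>{Suc m..s}. Q i \<inter> V j = {})"
  using \<open>m \<le> s\<close>
proof (induction m)
  case (Suc m)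
  then obtain Q where Q: "\<forall>i\<in>{1..m}. Q i \<in> \<Q> i"
    "\<forall>i\<in>{1..m}. \<forall>j\<in>{1..m}. i \<noteq> j \<longrightarrow> Q i \<inter> Q j = {}"
    "\<forall>i\<in>{1..m}. \<forall>j\<in>{Suc m..s}. Q i \<inter> V j = {}" by auto
  \<comment> \<open>The next kernel must avoid the \<open>m\<close> kernels already chosen, at most
    \<open>2 * m\<close> points, and the points reserved for later indices, at most
    \<open>s - Suc m\<close>; together fewer than \<open>2 * s\<close>.\<close>
  let ?U1 = "\<Union>i\<in>{1..m}. Q i" and ?U2 = "\<Union>j\<in>{Suc (Suc m)..s}. V j"
  have Qi: "finite (Q i) \<and> card (Q i) \<le> 2" if "i \<in> {1..m}" for i
    using Q(1) Q2[of i "Q i"] that Suc.prems by auto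
  have fin: "finite ?U1" "finite ?U2" using Qi V1 by auto
  have "card ?U1 \<le> (\<Sum>i\<in>{1..m}. card (Q i))" by (rule card_UN_le) auto
  also have "\<dots> \<le> (\<Sum>i\<in>{1..m}. 2)" using Qi by (intro sum_mono) auto
  finally have 1: "card ?U1 \<le> 2 * m" by simp
  have "card ?U2 \<le> (\<Sum>j\<in>{Suc (Suc m)..s}. card (V j))" by (rule card_UN_le) auto
  also have "\<dots> \<le> (\<Sum>j\<in>{Suc (Suc m)..s}. 1)" using V1 by (intro sum_mono) auto
  finally have 2: "card ?U2 \<le> s - Suc m" by simp
  have "card (?U1 \<union> ?U2) \<le> card ?U1 + card ?U2" by (rule card_Un_le)
  hence "card (?U1 \<union> ?U2) < 2 * s" using 1 2 Suc.prems by linarith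
  moreover have "(?U1 \<union> ?U2) \<inter> V (Suc m) = {}"
  proof -
    have "Q i \<inter> V (Suc m) = {}" if "i \<in> {1..m}" for i
      using bspec[OF bspec[OF Q(3) that], of "Suc m"] Suc.prems by auto
    moreover have "V j \<inter> V (Suc m) = {}" if "j \<in> {Suc (Suc m)..s}" for j
      using Vd[of j "Suc m"] that by auto
    ultimately show ?thesis by blast
  qed
  ultimately obtain P where P: "P \<in> \<Q> (Suc m)" "P \<inter> (?U1 \<union> ?U2) = {}"
    using ex[of "Suc m" "?U1 \<union> ?U2"] fin Suc.prems by auto
  have PQ: "P \<inter> Q i = {}" if "i \<in> {1..m}" for i using P(2) that by blast
  have PV: "P \<inter> V j = {}" if "j \<in> {Suc (Suc m)..s}" for j using P(2) that by blast
  let ?Q = "Q(Suc m := P)"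
  have "\<forall>i\<in>{1..Suc m}. ?Q i \<in> \<Q> i" using Q(1) P(1) by (auto simp: le_Suc_eq)
  moreover have "\<forall>i\<in>{1..Suc m}. \<forall>j\<in>{1..Suc m}. i \<noteq> j \<longrightarrow> ?Q i \<inter> ?Q j = {}"
  proof (intro ballI impI)
    fix i j assume ij: "i \<in> {1..Suc m}" "j \<in> {1..Suc m}" "i \<noteq> j"
    consider "i = Suc m" "j \<in> {1..m}" | "j = Suc m" "i \<in> {1..m}" | "i \<in> {1..m}" "j \<in> {1..m}"
      using ij by fastforce
    thus "?Q i \<inter> ?Q j = {}"
      using ij(3) Q(2) PQ by cases (auto simp: Int_commute)
  qed
  moreover have "\<forall>i\<in>{1..Suc m}. \<forall>j\<in>{Suc (Suc m)..s}. ?Q i \<inter> V j = {}"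
  proof (intro ballI)
    fix i j assume "i \<in> {1..Suc m}" "j \<in> {Suc (Suc m)..s}"
    thus "?Q i \<inter> V j = {}"
      using Q(3) PV by (cases "i = Suc m") auto
  qed
  ultimately show ?case by blast
qed auto

text \<open>Indices with the first alternative get distinct points \<open>v i\<close> of their sets,
  which is possible because the \<open>i\<close>-th set has at least \<open>i\<close> points; these
  points are reserved in \<open>P\<close>. The other indices can avoid any small set and reserve
  nothing.\<close>

lemma disjoint_kernels_exist:
  fixes \<Q> :: "nat \<Rightarrow> 'a set set"
  assumes Q2: "\<And>i Q. \<lbrakk>i \<in> {1..s}; Q \<in> \<Q> i\<rbrakk> \<Longrightarrow> finite Q \<and> card Q \<le> 2"
    and dich: "\<And>i. i \<in> {1..s} \<Longrightarrow>
      (\<exists>V. finite V \<and> i \<le> card V \<and>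
         (\<forall>v\<in>V. \<forall>U. finite U \<and> card U < 2 * s \<and> v \<notin> U \<longrightarrow> (\<exists>Q\<in>\<Q> i. Q \<inter> U = {})))
      \<or> (\<forall>U. finite U \<and> card U < 2 * s \<longrightarrow> (\<exists>Q\<in>\<Q> i. Q \<inter> U = {}))"
  shows "\<exists>Q. (\<forall>i\<in>{1..s}. Q i \<in> \<Q> i) \<and> (\<forall>i\<in>{1..s}. \<forall>j\<in>{1..s}. i \<noteq> j \<longrightarrow> Q i \<inter> Q j = {})"
proof -
  define pts where "pts i V \<longleftrightarrow> finite V \<and> i \<le> card V \<and>
         (\<forall>v\<in>V. \<forall>U. finite U \<and> card U < 2 * s \<and> v \<notin> U \<longrightarrow> (\<exists>Q\<in>\<Q> i. Q \<inter> U = {}))"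
    for i :: nat and V :: "'a set"
  define I where "I = {i \<in> {1..s}. \<exists>V. pts i V}"
  have "\<forall>i\<in>I. \<exists>V. pts i V" by (auto simp: I_def)
  then obtain V where V: "\<And>i. i \<in> I \<Longrightarrow> pts i (V i)" by metis
  have "\<exists>v. inj_on v (I \<inter> {1..s}) \<and> (\<forall>i\<in>I \<inter> {1..s}. v i \<in> V i)"
    by (rule distinct_representatives_exist) (use V in \<open>auto simp: pts_def\<close>)
  then obtain v where v: "inj_on v (I \<inter> {1..s})" "\<forall>i\<in>I \<inter> {1..s}. v i \<in> V i" by blast
  define P where "P i = (if i \<in> I then {v i} else {})" for i
  have "\<exists>Q. (\<forall>i\<in>{1..s}. Q i \<in> \<Q> i) \<and> (\<forall>i\<in>{1..s}. \<forall>j\<in>{1..s}. i \<noteq> j \<longrightarrow> Q i \<inter> Q j = {})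
           \<and> (\<forall>i\<in>{1..s}. \<forall>j\<in>{Suc s..s}. Q i \<inter> P j = {})"
  proof (rule disjoint_selection)
    show "P i \<inter> P j = {}" if "i \<in> {1..s}" "j \<in> {1..s}" "i \<noteq> j" for i j
      using that v(1) by (auto simp: P_def inj_on_def)
    show "\<exists>Q\<in>\<Q> i. Q \<inter> U = {}"
      if i: "i \<in> {1..s}" "finite U" "card U < 2 * s" "U \<inter> P i = {}" for i U
    proof (cases "i \<in> I")
      case True
      hence "v i \<in> V i" "v i \<notin> U" using v(2) i by (auto simp: P_def)
      thus ?thesis using V[OF True] i by (auto simp: pts_def)
    next
      case False
      hence "\<not> (\<exists>V. pts i V)" using i by (auto simp: I_def)
      thus ?thesis using dich[OF i(1)] i(2,3) unfolding pts_def by blast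
    qed
  qed (use Q2 in \<open>auto simp: P_def\<close>)
  then obtain Q where Q: "\<forall>i\<in>{1..s}. Q i \<in> \<Q> i"
    "\<forall>i\<in>{1..s}. \<forall>j\<in>{1..s}. i \<noteq> j \<longrightarrow> Q i \<inter> Q j = {}" by (elim exE conjE)
  thus ?thesis by (intro exI[of _ Q] conjI)
qed

section \<open>Small kernels in families of tuples\<close>

lemma card_tuples_containing_real:
  assumes "F \<subseteq> tuples n k" "n \<ge> 1"
  shows "real (card {x \<in> F. T \<subseteq> tuple_set k x}) \<le> real n ^ k / real n ^ card T"
proof -
  have "card {x \<in> F. T \<subseteq> tuple_set k x} \<le> card {x \<in> tuples n k. T \<subseteq> tuple_set k x}"
    using assms finite_tuples by (intro card_mono) auto
  hence "card {x \<in> F. T \<subseteq> tuple_set k x} * n ^ card T \<le> n ^ k"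
    by (rule order_trans[OF mult_le_mono1 card_tuples_containing])
  hence "real (card {x \<in> F. T \<subseteq> tuple_set k x}) * real n ^ card T \<le> real n ^ k"
    by (metis of_nat_le_iff of_nat_mult of_nat_power)
  thus ?thesis using assms(2) by (simp add: field_simps)
qed

text \<open>The size bound of \<open>obtain_kernel\<close> gives
  \<open>card F \<le> n ^ k * (R / n) ^ card Q\<close>. As \<open>R \<le> n\<close>, a kernel with
  three or more elements would force \<open>card F \<le> n ^ k * (R / n) ^ 3\<close>, which is at
  most \<open>n ^ (k - 1) / 2\<close>.\<close>

lemma tuples_kernel_card_le_2:
  fixes R :: real
  assumes F: "F \<subseteq> tuples n k" "real (card F) > real n ^ (k - 1) / 2"
    and n: "n \<ge> 1" "k \<ge> 1" and R: "R \<ge> 1" "2 * R ^ 3 \<le> real n ^ 2"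
  obtains Q where "kernel R F (tuple_set k) Q" "card Q \<le> 2"
proof -
  have "real (card F) > 0" using F(2) n by (smt (verit) divide_nonneg_nonneg zero_le_power of_nat_0_le_iff)
  hence "F \<noteq> {}" by auto
  moreover have "finite F" using F(1) finite_tuples finite_subset by blast
  ultimately obtain Q where Q: "kernel R F (tuple_set k) Q"
    "real (card F) \<le> real (card {x \<in> F. Q \<subseteq> tuple_set k x}) * R ^ card Q"
    using obtain_kernel[of F "tuple_set k" R] finite_tuple_set R by auto
  have "R \<le> n"
  proof (rule power2_le_imp_le)
    have "R ^ 2 \<le> R ^ 3" using R by (intro power_increasing) auto
    thus "R\<^sup>2 \<le> (real n)\<^sup>2" using R by (smt (verit) zero_le_power)
  qed simp
  have "card Q \<le> 2"
  proof (rule ccontr)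
    assume "\<not> card Q \<le> 2"
    hence c: "3 \<le> card Q" by simp
    have "real (card F) \<le> real n ^ k / real n ^ card Q * R ^ card Q"
      using Q(2) card_tuples_containing_real[OF F(1) n(1), of Q] R
      by (smt (verit) mult_right_mono zero_le_power)
    also have "\<dots> = real n ^ k * (R / n) ^ card Q" by (simp add: power_divide)
    also have "\<dots> \<le> real n ^ k * (R / n) ^ 3"
      using c R \<open>R \<le> n\<close> n by (intro mult_left_mono power_decreasing) auto
    also have "\<dots> \<le> real n ^ k * (1 / (2 * n))"
    proof (intro mult_left_mono)
      have "2 * R ^ 3 * n \<le> real n ^ 2 * n" using R by (intro mult_right_mono) auto
      also have "\<dots> = real n ^ 3" by (simp add: power3_eq_cube power2_eq_square)
      finally show "(R / n) ^ 3 \<le> 1 / (2 * n)" using n by (simp add: power_divide field_simps)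
    qed auto
    also have "\<dots> = real n ^ (k - 1) / 2"
      using n by (cases k) (auto simp: field_simps)
    finally show False using F(2) by simp
  qed
  with Q(1) show thesis by (rule that)
qed

text \<open>A point of \<open>V\<close> is either a singleton kernel or the centre of a star of at least \<open>2 * s\<close>
  two-element kernels.  If \<open>V\<close> is too small, the kernels missing \<open>V\<close> are pairs, and they form a
  graph of maximum degree less than \<open>2 * s\<close> with more than \<open>n / 2 \<ge> 4 * s\<^sup>2\<close> edges.\<close>

lemma tuples_kernel_dichotomy:
  fixes R :: real
  assumes F: "F \<subseteq> tuples n k" "real (card F) > real i * real n ^ (k - 1)"
    and n: "n \<ge> 1" "k \<ge> 1" and R: "R \<ge> 1" "2 * R ^ 3 \<le> real n ^ 2"
    and ns: "8 * real s ^ 2 \<le> n"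
  defines "\<Q> \<equiv> {Q. kernel R F (tuple_set k) Q \<and> card Q \<le> 2}"
  shows "(\<exists>V. finite V \<and> i \<le> card V \<and>
         (\<forall>v\<in>V. \<forall>U. finite U \<and> card U < 2 * s \<and> v \<notin> U \<longrightarrow> (\<exists>Q\<in>\<Q>. Q \<inter> U = {})))
      \<or> (\<forall>U. finite U \<and> card U < 2 * s \<longrightarrow> (\<exists>Q\<in>\<Q>. Q \<inter> U = {}))"
proof -
  let ?X = "{1..k} \<times> {1..n}"
  define good where "good v \<longleftrightarrow>
    (\<forall>U. finite U \<and> card U < 2 * s \<and> v \<notin> U \<longrightarrow> (\<exists>Q\<in>\<Q>. Q \<inter> U = {}))" for v :: "nat \<times> nat"
  define V where "V = {v \<in> ?X. good v}"
  have finV: "finite V" by (auto simp: V_def)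
  have finF: "finite F" using F(1) finite_tuples finite_subset by blast
  have QX: "Q \<subseteq> ?X" if "Q \<in> \<Q>" for Q
  proof -
    have "kernel R F (tuple_set k) Q" using that by (simp add: \<Q>_def)
    then obtain x where "x \<in> F" "Q \<subseteq> tuple_set k x" using kernel_subset_member by blast
    thus ?thesis using tuple_set_subset[of x n k] F(1) by blast
  qed
  have finQ: "finite Q" if "Q \<in> \<Q>" for Q using QX[OF that] finite_subset by blast
  \<comment> \<open>Otherwise \<open>F\<close> is covered by three parts: members through no small
    kernel, members through a point of \<open>V\<close>, and members through a small kernel missing
    \<open>V\<close>. They have at most \<open>n ^ (k - 1) / 2\<close>,
    \<open>(i - 1) * n ^ (k - 1)\<close> and \<open>n ^ (k - 1) / 2\<close> elements, which
    contradicts the size of \<open>F\<close>.\<close>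
  have "\<exists>Q\<in>\<Q>. Q \<inter> U = {}" if small: "card V < i" and U: "finite U" "card U < 2 * s" for U
  proof (rule ccontr)
    assume "\<not> ?thesis"
    hence meet: "\<And>Q. Q \<in> \<Q> \<Longrightarrow> Q \<inter> U \<noteq> {}" by blast
    define N where "N u = {w. w \<noteq> u \<and> {u, w} \<in> \<Q>}" for u
    let ?P = "{Q \<in> \<Q>. Q \<inter> V = {}}"
    let ?W = "{u \<in> U \<inter> ?X. \<not> good u}"
    have N: "finite (N u) \<and> card (N u) \<le> 2 * s - 1" if u: "u \<in> ?W" for u
    proof -
      \<comment> \<open>The set \<open>U'\<close> witnesses that \<open>u\<close> is not good. It
        avoids \<open>u\<close> but meets every pair \<open>{u, w}\<close> in \<open>\<Q>\<close>,
        so it contains all neighbours of \<open>u\<close>.\<close>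
      obtain U' where U': "finite U'" "card U' < 2 * s" "u \<notin> U'" "\<And>Q. Q \<in> \<Q> \<Longrightarrow> Q \<inter> U' \<noteq> {}"
        using u by (auto simp: good_def)
      have sub: "N u \<subseteq> U'"
      proof
        fix w assume "w \<in> N u"
        hence "{u, w} \<in> \<Q>" by (auto simp: N_def)
        from U'(4)[OF this] show "w \<in> U'" using U'(3) by auto
      qed
      thus ?thesis using finite_subset[OF sub U'(1)] card_mono[OF U'(1) sub] U'(2) by auto
    qed
    have P: "\<exists>u\<in>?W. \<exists>w\<in>N u. Q = {u, w}" if "Q \<in> ?P" for Q
    proof -
      have Q: "Q \<in> \<Q>" "Q \<inter> V = {}" using that by auto
      obtain u where u: "u \<in> Q" "u \<in> U" using meet[OF Q(1)] by auto
      have ng: "\<not> good u" using u Q QX[OF Q(1)] by (auto simp: V_def)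
      \<comment> \<open>A singleton kernel \<open>{u}\<close> misses every set that avoids
        \<open>u\<close>, which would make \<open>u\<close> good.\<close>
      have "Q \<noteq> {u}"
      proof
        assume "Q = {u}"
        hence "good u" using Q(1) by (auto simp: good_def intro!: bexI[of _ Q])
        thus False using ng by simp
      qed
      then obtain w where w: "w \<in> Q" "w \<noteq> u" using u by auto
      have "Q = {u, w}"
      proof (rule sym, rule card_seteq)
        show "card Q \<le> card {u, w}" using Q(1) w by (auto simp: \<Q>_def)
      qed (use finQ[OF Q(1)] u w in auto)
      thus ?thesis using ng u w Q QX[OF Q(1)] by (intro bexI[of _ u] bexI[of _ w]) (auto simp: N_def)
    qed
    have subP: "?P \<subseteq> (\<Union>u\<in>?W. (\<lambda>w. {u, w}) ` N u)" using P by fastforce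
    have finW: "finite ?W" using U by auto
    have finP: "finite ?P" using finW N by (intro finite_subset[OF subP]) auto
    have card2: "card Q = 2" if "Q \<in> ?P" for Q using P[OF that] by (auto simp: N_def)
    have "card ?P \<le> card (\<Union>u\<in>?W. (\<lambda>w. {u, w}) ` N u)"
      using finW N by (intro card_mono[OF _ subP]) auto
    also have "\<dots> \<le> (\<Sum>u\<in>?W. card ((\<lambda>w. {u, w}) ` N u))" by (rule card_UN_le[OF finW])
    also have "\<dots> \<le> (\<Sum>u\<in>?W. 2 * s - 1)"
      using N card_image_le order_trans by (intro sum_mono) blast
    also have "\<dots> \<le> (2 * s - 1) * (2 * s - 1)"
    proof -
      have "card ?W \<le> card U" using U by (intro card_mono) auto
      hence "card ?W \<le> 2 * s - 1" using U(2) by linarith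
      thus ?thesis unfolding sum_constant of_nat_id by (rule mult_le_mono1)
    qed
    also have "\<dots> \<le> (2 * s) * (2 * s)" by (intro mult_le_mono) auto
    finally have "card ?P \<le> 4 * s ^ 2" by (simp add: power2_eq_square)
    hence "real (card ?P) \<le> real (4 * s ^ 2)" by (simp only: of_nat_le_iff)
    also have "\<dots> = 4 * real s ^ 2" by simp
    finally have cP: "real (card ?P) \<le> n / 2" using ns by linarith
    \<comment> \<open>If this remainder were large, it would have a small kernel; by monotonicity
      that is a kernel of \<open>F\<close>, yet it lies in a member of \<open>F0\<close>.\<close>
    define F0 where "F0 = {x \<in> F. \<forall>Q\<in>\<Q>. \<not> Q \<subseteq> tuple_set k x}"
    have "real (card F0) \<le> real n ^ (k - 1) / 2"
    proof (rule ccontr)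
      assume "\<not> ?thesis"
      moreover have "F0 \<subseteq> tuples n k" using F(1) by (auto simp: F0_def)
      ultimately obtain Q where Q: "kernel R F0 (tuple_set k) Q" "card Q \<le> 2"
        using tuples_kernel_card_le_2[of F0 n k R] n R by auto
      have "Q \<in> \<Q>" using Q kernel_mono[OF Q(1), of F] by (auto simp: \<Q>_def F0_def)
      thus False using Q(1) by (auto simp: kernel_def F0_def)
    qed
    moreover have "real (card (\<Union>v\<in>V. {x \<in> F. {v} \<subseteq> tuple_set k x})) \<le> real (i - 1) * real n ^ (k - 1)"
    proof -
      have "real (card (\<Union>v\<in>V. {x \<in> F. {v} \<subseteq> tuple_set k x}))
          \<le> (\<Sum>v\<in>V. real (card {x \<in> F. {v} \<subseteq> tuple_set k x}))"
        using card_UN_le[OF finV, of "\<lambda>v. {x \<in> F. {v} \<subseteq> tuple_set k x}"]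
        by (simp only: of_nat_le_iff flip: of_nat_sum)
      also have "\<dots> \<le> (\<Sum>v\<in>V. real n ^ k / real n ^ 1)"
        using card_tuples_containing_real[OF F(1) n(1), where T = "{_}"] by (intro sum_mono) simp
      also have "\<dots> = card V * real n ^ (k - 1)" using n by (cases k) auto
      also have "\<dots> \<le> real (i - 1) * real n ^ (k - 1)" using small by (intro mult_right_mono) auto
      finally show ?thesis .
    qed
    moreover have "real (card (\<Union>Q\<in>?P. {x \<in> F. Q \<subseteq> tuple_set k x})) \<le> real n ^ (k - 1) / 2"
    proof -
      have "real (card (\<Union>Q\<in>?P. {x \<in> F. Q \<subseteq> tuple_set k x}))
          \<le> (\<Sum>Q\<in>?P. real (card {x \<in> F. Q \<subseteq> tuple_set k x}))"
        using card_UN_le[OF finP, of "\<lambda>Q. {x \<in> F. Q \<subseteq> tuple_set k x}"]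
        by (simp only: of_nat_le_iff flip: of_nat_sum)
      also have "\<dots> \<le> (\<Sum>Q\<in>?P. real n ^ k / real n ^ 2)"
      proof (rule sum_mono)
        fix Q assume "Q \<in> ?P"
        hence "card Q = 2" by (rule card2)
        thus "real (card {x \<in> F. Q \<subseteq> tuple_set k x}) \<le> real n ^ k / real n ^ 2"
          using card_tuples_containing_real[OF F(1) n(1), of Q] by simp
      qed
      also have "\<dots> = card ?P * (real n ^ k / real n ^ 2)" by simp
      also have "\<dots> \<le> n / 2 * (real n ^ k / real n ^ 2)" using cP by (intro mult_right_mono) auto
      also have "\<dots> = real n ^ (k - 1) / 2" using n by (cases k) (auto simp: field_simps power2_eq_square)
      finally show ?thesis .
    qed
    moreover have "real (card F) \<le> real (card F0) + real (card (\<Union>v\<in>V. {x \<in> F. {v} \<subseteq> tuple_set k x}))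
        + real (card (\<Union>Q\<in>?P. {x \<in> F. Q \<subseteq> tuple_set k x}))"
    proof -
      let ?A = "\<Union>v\<in>V. {x \<in> F. {v} \<subseteq> tuple_set k x}" and ?B = "\<Union>Q\<in>?P. {x \<in> F. Q \<subseteq> tuple_set k x}"
      have "F \<subseteq> F0 \<union> ?A \<union> ?B"
      proof
        fix x assume "x \<in> F"
        show "x \<in> F0 \<union> ?A \<union> ?B"
        proof (cases "\<exists>Q\<in>\<Q>. Q \<subseteq> tuple_set k x")
          case True
          then obtain Q where "Q \<in> \<Q>" "Q \<subseteq> tuple_set k x" by auto
          thus ?thesis using \<open>x \<in> F\<close> by (cases "Q \<inter> V = {}") auto
        qed (use \<open>x \<in> F\<close> in \<open>auto simp: F0_def\<close>)
      qed
      hence "card F \<le> card (F0 \<union> ?A \<union> ?B)"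
        using finF by (intro card_mono) (auto simp: F0_def intro: finite_subset)
      also have "\<dots> \<le> card F0 + card ?A + card ?B"
        using card_Un_le[of "F0 \<union> ?A" ?B] card_Un_le[of F0 ?A] by linarith
      finally show ?thesis by linarith
    qed
    ultimately have "real (card F) \<le> (real (i - 1) + 1) * real n ^ (k - 1)"
      by (simp add: algebra_simps)
    \<comment> \<open>From \<open>card V < i\<close> follows \<open>i > 0\<close>, so the truncated
      subtraction is exact.\<close>
    also have "real (i - 1) + 1 = real i" using small by simp
    finally show False using F(2) by simp
  qed
  moreover have "\<forall>v\<in>V. good v" by (simp add: V_def)
  ultimately show ?thesis
    unfolding good_def using finV not_less by metis
qed

section \<open>From disjoint kernels to a rainbow matching\<close>

lemma spread_Diff_avoiding:
  fixes R :: real and E :: "'i \<Rightarrow> 'a set"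
  assumes spr: "spread R G (\<lambda>x. E x - Q)" and G: "finite G" "\<And>x. x \<in> G \<Longrightarrow> Q \<subseteq> E x"
    and U: "finite U" "U \<inter> Q = {}" "2 * real (card U) \<le> R" and R: "R \<ge> 2"
  defines "H \<equiv> {x \<in> G. E x \<inter> U = {}}"
  shows "card G \<le> 2 * card H" "spread (R / 2) H (\<lambda>x. E x - Q)"
proof -
  \<comment> \<open>A point of \<open>U\<close> is not in \<open>Q\<close>, so spreadness for
    singletons puts it in at most \<open>card G / R\<close> of the sets; all of \<open>U\<close>
    spoils at most half of \<open>G\<close>.\<close>
  let ?B = "\<lambda>u. {x \<in> G. {u} \<subseteq> E x - Q}"
  have "real (card (\<Union>u\<in>U. ?B u)) \<le> (\<Sum>u\<in>U. real (card (?B u)))"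
    using card_UN_le[OF U(1), of ?B] by (simp only: of_nat_le_iff flip: of_nat_sum)
  also have "\<dots> \<le> (\<Sum>u\<in>U. card G / R)"
  proof (rule sum_mono)
    fix u
    have "real (card (?B u)) * R ^ card {u} \<le> card G"
      using spr unfolding spread_def by blast
    thus "real (card (?B u)) \<le> card G / R" using R by (simp add: field_simps)
  qed
  also have "\<dots> = card G * (card U / R)" by simp
  also have "\<dots> \<le> card G * (1 / 2)" using U(3) R by (intro mult_left_mono) (auto simp: field_simps)
  finally have 1: "2 * real (card (\<Union>u\<in>U. ?B u)) \<le> card G" by simp
  have "G \<subseteq> H \<union> (\<Union>u\<in>U. ?B u)" using U(2) by (auto simp: H_def)
  hence "card G \<le> card (H \<union> (\<Union>u\<in>U. ?B u))"
    using G(1) U(1) by (intro card_mono) (auto simp: H_def)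
  also have "\<dots> \<le> card H + card (\<Union>u\<in>U. ?B u)" by (rule card_Un_le)
  finally show GH: "card G \<le> 2 * card H" using 1 by linarith
  show "spread (R / 2) H (\<lambda>x. E x - Q)"
    unfolding spread_def
  proof (intro allI impI)
    fix T :: "'a set" assume T: "finite T"
    have HG: "card {x \<in> H. T \<subseteq> E x - Q} \<le> card {x \<in> G. T \<subseteq> E x - Q}"
      using G(1) by (intro card_mono) (auto simp: H_def)
    show "real (card {x \<in> H. T \<subseteq> E x - Q}) * (R / 2) ^ card T \<le> real (card H)"
    \<comment> \<open>Passing from \<open>G\<close> to \<open>H\<close> may halve the size, which
      the factor \<open>2 ^ card T\<close> from halving \<open>R\<close> repays as soon as
      \<open>T\<close> is nonempty.\<close>
    proof (cases "T = {}")
      case False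
      hence "2 ^ 1 \<le> (2::real) ^ card T"
        using T by (intro power_increasing) (auto simp: Suc_le_eq card_gt_0_iff)
      hence "1 \<le> (2::real) ^ card T / 2" by simp
      hence "real (card {x \<in> H. T \<subseteq> E x - Q}) * (R / 2) ^ card T * 1
          \<le> real (card {x \<in> H. T \<subseteq> E x - Q}) * (R / 2) ^ card T * (2 ^ card T / 2)"
        using R by (intro mult_left_mono) auto
      also have "\<dots> = real (card {x \<in> H. T \<subseteq> E x - Q}) * R ^ card T / 2"
        by (simp add: power_divide)
      also have "\<dots> \<le> real (card {x \<in> G. T \<subseteq> E x - Q}) * R ^ card T / 2"
        using HG R by (intro divide_right_mono mult_right_mono) auto
      also have "\<dots> \<le> card G / 2"
        using spr T unfolding spread_def by (intro divide_right_mono) auto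
      also have "\<dots> \<le> card H" using GH by linarith
      finally show ?thesis by simp
    qed simp
  qed
qed

text \<open>Each family \<open>G i\<close> is thinned to the members avoiding all other kernels,
  which have at most \<open>2 * s\<close> points in total. This halves the spread parameter, hence
  16 where the colouring asks for 8. The colouring makes the sets \<open>?E (a i) - Q i\<close>
  disjoint, and the thinning keeps every kernel off the other tuples, so whole tuples are
  disjoint.\<close>

lemma rainbow_matching_of_kernels:
  fixes R :: real and Q :: "nat \<Rightarrow> (nat \<times> nat) set"
  assumes F: "\<And>i. i \<in> {1..s} \<Longrightarrow> \<F> i \<subseteq> tuples n k"
    and Q: "\<And>i. i \<in> {1..s} \<Longrightarrow> kernel R (\<F> i) (tuple_set k) (Q i)"
      "\<And>i. i \<in> {1..s} \<Longrightarrow> card (Q i) \<le> 2"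
      "\<And>i j. \<lbrakk>i \<in> {1..s}; j \<in> {1..s}; i \<noteq> j\<rbrakk> \<Longrightarrow> Q i \<inter> Q j = {}"
    and R: "4 * real s \<le> R" "16 * real (s * m) \<le> R" and m: "m > 0" "s * k < 2 ^ m" and s: "s \<ge> 1"
  shows "\<exists>F. rainbow_matching k s \<F> F"
proof -
  let ?E = "tuple_set k"
  have "\<forall>i\<in>{1..s}. \<exists>G\<subseteq>\<F> i. G \<noteq> {} \<and> (\<forall>x\<in>G. Q i \<subseteq> ?E x) \<and> spread R G (\<lambda>x. ?E x - Q i)"
    using Q(1) by (simp add: kernel_def)
  from bchoice[OF this] obtain G where G0: "\<forall>i\<in>{1..s}. G i \<subseteq> \<F> i \<and> G i \<noteq> {} \<and>
      (\<forall>x\<in>G i. Q i \<subseteq> ?E x) \<and> spread R (G i) (\<lambda>x. ?E x - Q i)" ..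
  have G: "G i \<subseteq> \<F> i" "G i \<noteq> {}" "\<And>x. x \<in> G i \<Longrightarrow> Q i \<subseteq> ?E x"
    "spread R (G i) (\<lambda>x. ?E x - Q i)" if "i \<in> {1..s}" for i
    using bspec[OF G0 that] by blast+
  have finG: "finite (G i)" if "i \<in> {1..s}" for i
    by (rule finite_subset[OF order_trans[OF G(1)[OF that] F[OF that]] finite_tuples])
  have finQ: "finite (Q i)" if i: "i \<in> {1..s}" for i
  proof -
    obtain x where "x \<in> G i" using G(2)[OF i] by blast
    thus ?thesis using finite_subset[OF G(3)[OF i] finite_tuple_set] by simp
  qed
  define U where "U i = (\<Union>j\<in>{1..s} - {i}. Q j)" for i
  define H where "H i = {x \<in> G i. ?E x \<inter> U i = {}}" for i
  have H: "card (G i) \<le> 2 * card (H i)" "spread (R / 2) (H i) (\<lambda>x. ?E x - Q i)" if i: "i \<in> {1..s}" for i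
  proof -
    have "card (U i) \<le> (\<Sum>j\<in>{1..s} - {i}. card (Q j))"
      unfolding U_def by (rule card_UN_le) auto
    also have "\<dots> \<le> (\<Sum>j\<in>{1..s} - {i}. 2)" using Q(2) by (intro sum_mono) auto
    also have "\<dots> \<le> 2 * s" using i by simp
    finally have "2 * real (card (U i)) \<le> R" using R(1) by linarith
    moreover have "finite (U i)" using finQ by (auto simp: U_def)
    moreover have "U i \<inter> Q i = {}" using Q(3)[OF _ i] unfolding U_def by blast
    moreover have "R \<ge> 2" using R(1) s by linarith
    ultimately show "card (G i) \<le> 2 * card (H i)" "spread (R / 2) (H i) (\<lambda>x. ?E x - Q i)"
      using spread_Diff_avoiding[OF G(4)[OF i] finG[OF i] G(3)[OF i], of "U i"]
      unfolding H_def by auto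
  qed
  obtain a where a: "\<And>i. i \<in> {1..s} \<Longrightarrow> a i \<in> H i"
    "\<And>i j. \<lbrakk>i \<in> {1..s}; j \<in> {1..s}; i \<noteq> j\<rbrakk> \<Longrightarrow> (?E (a i) - Q i) \<inter> (?E (a j) - Q j) = {}"
  proof (rule spread_disjoint_members[of "{1..s}" "{1..k} \<times> {1..n}" H "\<lambda>i x. ?E x - Q i" k "R / 2" m])
    show "finite (H i)" if "i \<in> {1..s}" for i using finG[OF that] by (auto simp: H_def)
    show "H i \<noteq> {}" if "i \<in> {1..s}" for i
    proof
      assume "H i = {}"
      hence "card (G i) = 0" using H(1)[OF that] by simp
      thus False using G(2)[OF that] finG[OF that] by simp
    qed
    show "?E x - Q i \<subseteq> {1..k} \<times> {1..n}" if "i \<in> {1..s}" "x \<in> H i" for i x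
    proof -
      have "x \<in> tuples n k" using that G(1)[OF that(1)] F[OF that(1)] by (auto simp: H_def)
      thus ?thesis using tuple_set_subset by blast
    qed
    show "card (?E x - Q i) \<le> k" if "i \<in> {1..s}" "x \<in> H i" for i x
      using card_mono[OF finite_tuple_set, of "?E x - Q i" k x] by (simp add: card_tuple_set)
    show "spread (R / 2) (H i) (\<lambda>x. ?E x - Q i)" if "i \<in> {1..s}" for i using H(2)[OF that] .
    show "8 * real (card {1..s} * m) \<le> R / 2" using R(2) by simp
    show "card {1..s} * k < 2 ^ m" using m by simp
  qed (use m in auto)
  have "?E (a i) \<inter> ?E (a j) = {}" if "i \<in> {1..s}" "j \<in> {1..s}" "i \<noteq> j" for i j
  proof -
    have "?E (a i) \<inter> U i = {}" "?E (a j) \<inter> U j = {}"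
      using a(1)[OF that(1)] a(1)[OF that(2)] by (simp_all add: H_def)
    moreover have "Q j \<subseteq> U i" "Q i \<subseteq> U j" using that unfolding U_def by blast+
    ultimately have "?E (a i) \<inter> Q j = {}" "?E (a j) \<inter> Q i = {}" by blast+
    thus ?thesis using a(2)[OF that] by blast
  qed
  hence "disjoint_family_on (\<lambda>i. ?E (a i)) {1..s}" by (auto simp: disjoint_family_on_def)
  moreover have "a i \<in> \<F> i" if "i \<in> {1..s}" for i using a(1)[OF that] G(1)[OF that] by (auto simp: H_def)
  ultimately show ?thesis unfolding rainbow_matching_def by blast
qed

theorem theorem1:
  fixes n k s :: nat
  assumes "n \<ge> 1" and "k \<ge> 1" and "s \<ge> 1"
    and "real n \<ge> max (2 ^ 8 * real s powr (3 / 2) * log 2 (real (s * k)) powr (3 / 2))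
                       (8 * real s ^ 2)"
  shows "satisfying n k s (\<lambda>i. real i * real n ^ (k - 1))"
  unfolding satisfying_def
proof (intro allI impI)
  fix \<F> assume \<F>: "\<forall>i\<in>{1..s}. \<F> i \<subseteq> tuples n k \<and> real (card (\<F> i)) > real i * real n ^ (k - 1)"
  show "\<exists>F. rainbow_matching k s \<F> F"
  \<comment> \<open>For \<open>s = 1\<close> any member will do. For \<open>s \<ge> 2\<close> the
    logarithm is at least 1 even when \<open>k = 1\<close>.\<close>
  proof (cases "s = 1")
    case True
    have "1 \<in> {1..s}" using assms(3) by simp
    from bspec[OF \<F> this] have "real 1 * real n ^ (k - 1) < real (card (\<F> 1))" ..
    hence "real (card (\<F> 1)) > 0" by (smt (verit) zero_le_power of_nat_0_le_iff mult_nonneg_nonneg)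
    hence "\<F> 1 \<noteq> {}" by auto
    then obtain x where "x \<in> \<F> 1" by auto
    hence "rainbow_matching k s \<F> (\<lambda>_. x)"
      using True by (auto simp: rainbow_matching_def disjoint_family_on_def)
    thus ?thesis by blast
  next
    case False
    define L where "L = log 2 (real (s * k))"
    \<comment> \<open>The number \<open>m\<close> of colours per index satisfies
      \<open>L < m\<close>, whence \<open>s * k < 2 ^ m\<close>, and \<open>m \<le> 2 * L\<close>,
      whence \<open>16 * s * m \<le> R\<close>; this fixes the constant 32.\<close>
    define R where "R = 32 * real s * L"
    define m where "m = nat \<lfloor>L\<rfloor> + 1"
    have s2: "s \<ge> 2" using False assms(3) by simp
    have sk: "s * k \<ge> 2" using mult_le_mono[OF s2 assms(2)] by simp
    have "real (s * k) \<ge> 2" using sk by (metis of_nat_le_iff of_nat_numeral)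
    hence L: "L \<ge> 1" by (simp add: L_def le_log_iff)
    have m: "L < real m" "real m \<le> 2 * L" using L by (auto simp: m_def) linarith+
    have "real (s * k) > 0" using sk by linarith
    hence "real (s * k) = 2 powr L" unfolding L_def by (intro powr_log_cancel[symmetric]) auto
    also have "\<dots> < 2 powr real m" using m by simp
    finally have skm: "s * k < 2 ^ m"
      by (metis of_nat_less_iff of_nat_numeral of_nat_power powr_realpow zero_less_numeral)
    have sL: "1 * 1 \<le> real s * L" using s2 L by (intro mult_mono) auto
    have n1: "2 ^ 8 * real s powr (3 / 2) * L powr (3 / 2) \<le> n" and n2: "8 * real s ^ 2 \<le> n"
      using assms(4) by (auto simp: L_def)
    have R1: "R \<ge> 1" using sL by (simp add: R_def)
    have sq: "(x powr (3 / 2)) ^ 2 = x ^ 3" if "x > 0" for x :: real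
      using that by (simp add: powr_power)
    \<comment> \<open>Since \<open>2 * 32 ^ 3\<close> is the square of \<open>2 ^ 8\<close>, the
      first lower bound on \<open>n\<close> amounts to \<open>2 * R ^ 3 \<le> n ^ 2\<close>.\<close>
    have "2 * R ^ 3 = 2 ^ 16 * (real s ^ 3 * L ^ 3)" by (simp add: R_def power_mult_distrib)
    also have "\<dots> = (2 ^ 8 * real s powr (3 / 2) * L powr (3 / 2)) ^ 2"
      using s2 L by (simp add: power_mult_distrib sq)
    also have "\<dots> \<le> real n ^ 2" using n1 by (intro power_mono) auto
    finally have R3: "2 * R ^ 3 \<le> real n ^ 2" .
    let ?\<Q> = "\<lambda>i. {Q. kernel R (\<F> i) (tuple_set k) Q \<and> card Q \<le> 2}"
    have fin: "finite P \<and> card P \<le> 2" if P: "P \<in> ?\<Q> i" for P i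
    proof -
      have "kernel R (\<F> i) (tuple_set k) P" using P by simp
      from kernel_subset_member[OF this] obtain x where x: "P \<subseteq> tuple_set k x" by auto
      show ?thesis using finite_subset[OF x finite_tuple_set] P by simp
    qed
    have dich: "(\<exists>V. finite V \<and> i \<le> card V \<and>
         (\<forall>v\<in>V. \<forall>U. finite U \<and> card U < 2 * s \<and> v \<notin> U \<longrightarrow> (\<exists>Q\<in>?\<Q> i. Q \<inter> U = {})))
         \<or> (\<forall>U. finite U \<and> card U < 2 * s \<longrightarrow> (\<exists>Q\<in>?\<Q> i. Q \<inter> U = {}))" if i: "i \<in> {1..s}" for i
    proof -
      from bspec[OF \<F> i] have "\<F> i \<subseteq> tuples n k" "real (card (\<F> i)) > real i * real n ^ (k - 1)" by simp_all
      thus ?thesis by (rule tuples_kernel_dichotomy[OF _ _ assms(1,2) R1 R3 n2])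
    qed
    have "\<exists>Q. (\<forall>i\<in>{1..s}. Q i \<in> ?\<Q> i) \<and> (\<forall>i\<in>{1..s}. \<forall>j\<in>{1..s}. i \<noteq> j \<longrightarrow> Q i \<inter> Q j = {})"
      by (rule disjoint_kernels_exist) (rule fin, assumption, rule dich, assumption)
    then obtain Q where Q: "\<forall>i\<in>{1..s}. Q i \<in> ?\<Q> i"
      "\<forall>i\<in>{1..s}. \<forall>j\<in>{1..s}. i \<noteq> j \<longrightarrow> Q i \<inter> Q j = {}" by (elim exE conjE)
    show ?thesis
    proof (rule rainbow_matching_of_kernels[where Q = Q and R = R and m = m])
      have "real s * 1 \<le> real s * L" using L by (intro mult_left_mono) auto
      thus "4 * real s \<le> R" unfolding R_def using sL by linarith
      have "real s * real m \<le> real s * (2 * L)" using m by (intro mult_left_mono) auto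
      thus "16 * real (s * m) \<le> R" by (simp add: R_def mult_ac)
      show "m > 0" by (simp add: m_def)
    qed (use Q \<F> skm assms(3) in auto)
  qed
qed

end
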